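(* Let $k$ be an algebraically closed field of characteristic zero, let $m\ge 1$, let $h\in k[x]$ be a monic polynomial of degree $2m+1$, and let $\mathcal{H}$ be the hyperelliptic curve $y^2 = 2h(x)$, assumed to be non-singular, i.e. $\gcd(h(x),h'(x))=1$. Let $\mathcal{D}_{\mathcal{H}}$ be the Lie algebra of polynomial vector fields on $\mathcal{H}$, and let $\eta$ be a non-zero vector field in $\mathcal{D}_{\mathcal{H}}$. Then: (1) $\mathrm{Ker}\,\mathrm{ad}(\eta) = k\eta$. (2) $\eta\notin \mathrm{Im}\,\mathrm{ad}(\eta)$. (3) $\mathcal{D}_{\mathcal{H}}$ has no non-trivial (i.e. non-zero) semisimple elements. (4) $\mathcal{D}_{\mathcal{H}}$ has no non-trivial (i.e. non-zero) nilpotent elements.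
   Context: The algebra of polynomial functions on $\mathcal{H}$ is $A = k[x,y]/\langle y^2-2h(x)\rangle$, and $\mathcal{D}_{\mathcal{H}} = \mathrm{Der}_k(A)$ is the Lie algebra of $k$-linear derivations of $A$. Here $\mathrm{ad}(\eta)$ is the operator $\nu\mapsto[\eta,\nu]$ on $\mathcal{D}_{\mathcal{H}}$. An element $\nu\in\mathcal{D}_{\mathcal{H}}$ is semisimple if $\mathrm{ad}(\nu)$ is diagonalizable on $\mathcal{D}_{\mathcal{H}}$ (i.e. $\mathcal{D}_{\mathcal{H}}$ is spanned by eigenvectors of $\mathrm{ad}(\nu)$), and nilpotent if $\mathrm{ad}(\nu)$ is a nilpotent operator. *)

theory Defs
  imports
    "HOL-Algebra.Algebraic_Closure_Type"
    "HOL-Algebra.QuotRing"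
    "HOL-Algebra.Module"
    "HOL-Library.FuncSet"
begin

definition eigenvectors ::
  "('k, 'r) ring_scheme \<Rightarrow> ('k, 'v, 's) module_scheme \<Rightarrow> ('v \<Rightarrow> 'v) \<Rightarrow> 'v set"
  where "eigenvectors R V T =
    {v \<in> carrier V. v \<noteq> \<zero>\<^bsub>V\<^esub> \<and> (\<exists>c\<in>carrier R. T v = c \<odot>\<^bsub>V\<^esub> v)}"

definition diagonalizable ::
  "('k, 'r) ring_scheme \<Rightarrow> ('k, 'v, 's) module_scheme \<Rightarrow> ('v \<Rightarrow> 'v) \<Rightarrow> bool"
  where "diagonalizable R V T \<longleftrightarrow>
    (\<forall>v\<in>carrier V. \<exists>F c. finite F \<and> F \<subseteq> eigenvectors R V T \<and> c \<in> F \<rightarrow> carrier R \<and>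
       v = finsum V (\<lambda>w. c w \<odot>\<^bsub>V\<^esub> w) F)"

definition nilpotent_operator ::
  "('v, 's) ring_scheme \<Rightarrow> ('v \<Rightarrow> 'v) \<Rightarrow> bool"
  where "nilpotent_operator V T \<longleftrightarrow> (\<exists>n. \<forall>v\<in>carrier V. (T ^^ n) v = \<zero>\<^bsub>V\<^esub>)"

text \<open>
  Derivations are extensional (\<open>undefined\<close> outside \<open>carrier A\<close>), so that two derivations are equal iff they agree on \<open>carrier A\<close>.
\<close>

definition derivations ::
  "('k, 'r) ring_scheme \<Rightarrow> ('k, 'a, 's) module_scheme \<Rightarrow> ('a \<Rightarrow> 'a) set"
  where "derivations R A =
    {D \<in> carrier A \<rightarrow>\<^sub>E carrier A.
       (\<forall>a\<in>carrier A. \<forall>b\<in>carrier A. D (a \<oplus>\<^bsub>A\<^esub> b) = D a \<oplus>\<^bsub>A\<^esub> D b) \<and>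
       (\<forall>c\<in>carrier R. \<forall>a\<in>carrier A. D (c \<odot>\<^bsub>A\<^esub> a) = c \<odot>\<^bsub>A\<^esub> D a) \<and>
       (\<forall>a\<in>carrier A. \<forall>b\<in>carrier A.
          D (a \<otimes>\<^bsub>A\<^esub> b) = (D a \<otimes>\<^bsub>A\<^esub> b) \<oplus>\<^bsub>A\<^esub> (a \<otimes>\<^bsub>A\<^esub> D b))}"

text \<open>
  The \<open>module\<close> record is reused for a Lie algebra: \<open>mult\<close> is the Lie bracket, which is neither
  associative nor unital, so the field \<open>one\<close> is meaningless and left unspecified.
\<close>

definition Der ::
  "('k, 'r) ring_scheme \<Rightarrow> ('k, 'a, 's) module_scheme \<Rightarrow> ('k, 'a \<Rightarrow> 'a) module"
  where "Der R A = \<lparr>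
    carrier = derivations R A,
    monoid.mult = (\<lambda>D E. \<lambda>a\<in>carrier A. D (E a) \<ominus>\<^bsub>A\<^esub> E (D a)),
    monoid.one = undefined,
    ring.zero = (\<lambda>a\<in>carrier A. \<zero>\<^bsub>A\<^esub>),
    ring.add = (\<lambda>D E. \<lambda>a\<in>carrier A. D a \<oplus>\<^bsub>A\<^esub> E a),
    module.smult = (\<lambda>c D. \<lambda>a\<in>carrier A. c \<odot>\<^bsub>A\<^esub> D a)\<rparr>"

definition ad :: "('v, 's) ring_scheme \<Rightarrow> 'v \<Rightarrow> 'v \<Rightarrow> 'v"
  where "ad L \<eta> = (\<lambda>\<nu>. \<eta> \<otimes>\<^bsub>L\<^esub> \<nu>)"

definition semisimple_element ::
  "('k, 'r) ring_scheme \<Rightarrow> ('k, 'v, 's) module_scheme \<Rightarrow> 'v \<Rightarrow> bool"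
  where "semisimple_element R L \<nu> \<longleftrightarrow> diagonalizable R L (ad L \<nu>)"

definition nilpotent_element :: "('v, 's) ring_scheme \<Rightarrow> 'v \<Rightarrow> bool"
  where "nilpotent_element L \<nu> \<longleftrightarrow> nilpotent_operator L (ad L \<nu>)"

text \<open>
  \<open>k[x,y]\<close> is represented by the type \<open>'a poly poly\<close> of polynomials in \<open>y\<close> over \<open>k[x]\<close>:
  \<open>y\<close> is \<open>[:0, 1:]\<close>, a polynomial \<open>p\<close> in \<open>x\<close> is \<open>[:p:]\<close>, and a constant \<open>c\<close> is \<open>[:[:c:]:]\<close>.
  The scalar action of \<open>k\<close> on the quotient is multiplication by the class of the constant.
\<close>

abbreviation base_field :: "'a::field ring"
  where "base_field \<equiv> ring_of_type_algebra"

abbreviation kxy :: "'a::field poly poly ring"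
  where "kxy \<equiv> ring_of_type_algebra"

definition curve_ideal :: "'a::field poly \<Rightarrow> 'a poly poly set"
  where "curve_ideal h = Idl\<^bsub>kxy\<^esub> {[:0, 1:] ^ 2 - [:2 * h:]}"

definition curve_algebra :: "'a::field poly \<Rightarrow> ('a, 'a poly poly set) module"
  where "curve_algebra h = ring.extend (kxy Quot curve_ideal h)
    (module.fields
      (\<lambda>c a. (curve_ideal h +>\<^bsub>kxy\<^esub> [:[:c:]:]) \<otimes>\<^bsub>kxy Quot curve_ideal h\<^esub> a))"

definition vector_fields :: "'a::field poly \<Rightarrow> ('a, 'a poly poly set \<Rightarrow> 'a poly poly set) module"
  where "vector_fields h = Der base_field (curve_algebra h)"

end

(*
  Since h and h' are coprime, the derivations of A are exactly the multiples f tau of the vector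
  field tau = y d/dx + h' d/dy, and [f tau, g tau] = (f tau(g) - g tau(f)) tau. Give x weight 2 and
  y weight 2m+1. If f and g have weights w and v with w \<noteq> v, the leading terms of f tau(g) and
  g tau(f) do not cancel, so the bracket has weight w + v + 2m - 1 > max w v. Subtracting from g the
  multiple of f with the same leading term, one finds that [f tau, g tau] = c g tau with f, g \<noteq> 0
  forces c = 0 and g \<in> k f. This gives (1) and, with f and g exchanged, (2). It also confines all
  eigenvectors of ad to its kernel, which is a line while D is not, giving (3). By (1) and (2),
  ad^2 \<nu> = 0 implies ad \<nu> = 0, which gives (4).
*)

theory Submission
  imports Defs
begin

section \<open>Leading coefficients with respect to the weight of x\<close>

text \<open>
  The weight \<open>w\<close> is an integer that may be odd or negative, where the coefficient is \<open>0\<close>: then a single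
  rule covers both components of \<open>p + q y\<close>, and no truncated subtraction occurs.
\<close>

definition leads :: "'a::comm_ring_1 poly \<Rightarrow> int \<Rightarrow> 'a \<Rightarrow> bool"
  where "leads p w a \<longleftrightarrow>
    (\<forall>i. w < 2 * int i \<longrightarrow> Polynomial.coeff p i = 0) \<and>
    (\<forall>i. 2 * int i = w \<longrightarrow> Polynomial.coeff p i = a) \<and>
    ((\<nexists>i. 2 * int i = w) \<longrightarrow> a = 0)"

lemma leads_even: "leads p w a \<Longrightarrow> a \<noteq> 0 \<Longrightarrow> even w"
  unfolding leads_def by (metis dvd_triv_left)

lemma leads_unique: "leads p w a \<Longrightarrow> leads p w b \<Longrightarrow> a = b"
  unfolding leads_def by metis

lemma leads_zero: "leads 0 w 0"
  by (simp add: leads_def)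

lemma leads_above: "leads p w a \<Longrightarrow> w < v \<Longrightarrow> leads p v 0"
  by (auto simp: leads_def)

lemma leads_degree: "leads p (2 * int (Polynomial.degree p)) (Polynomial.lead_coeff p)"
  by (auto simp: leads_def coeff_eq_0)

lemma leads_add: "leads p w a \<Longrightarrow> leads q w b \<Longrightarrow> leads (p + q) w (a + b)"
  by (auto simp: leads_def)

lemma leads_diff: "leads p w a \<Longrightarrow> leads q w b \<Longrightarrow> leads (p - q) w (a - b)"
  by (auto simp: leads_def)

lemma leads_smult: "leads p w a \<Longrightarrow> leads (Polynomial.smult c p) w (c * a)"
  by (auto simp: leads_def)

text \<open>A pair of exponents whose weights add up to \<open>v + w\<close> or more either exceeds
  one of the two bounds or meets both exactly, so at most one summand of the convolution
  survives.\<close>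

lemma leads_mult:
  assumes p: "leads p v a" and q: "leads q w b"
  shows "leads (p * q) (v + w) (a * b)"
proof -
  have out: "Polynomial.coeff p j * Polynomial.coeff q (i - j) = 0"
    if "j \<le> i" "v + w \<le> 2 * int i" "2 * int j \<noteq> v \<or> 2 * int (i - j) \<noteq> w" for i j
  proof -
    have "v < 2 * int j \<or> w < 2 * int (i - j)"
      using that by (auto simp: of_nat_diff)
    then show ?thesis using p q by (auto simp: leads_def)
  qed
  have 1: "Polynomial.coeff (p * q) i = 0" if "v + w < 2 * int i" for i
    unfolding coeff_mult
    by (rule sum.neutral) (use that in \<open>auto intro!: out simp: of_nat_diff\<close>)
  have 2: "Polynomial.coeff (p * q) i = a * b" if i: "2 * int i = v + w" for i
  proof (cases "\<exists>j\<le>i. 2 * int j = v")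
    case True
    then obtain j where j: "j \<le> i" "2 * int j = v" by blast
    have w: "2 * int (i - j) = w" using i j by (simp add: of_nat_diff)
    have "Polynomial.coeff (p * q) i = (\<Sum>l\<in>{j}. Polynomial.coeff p l * Polynomial.coeff q (i - l))"
      unfolding coeff_mult
      by (rule sum.mono_neutral_right) (use i j in \<open>auto intro!: out\<close>)
    then show ?thesis using p q j w by (auto simp: leads_def)
  next
    case False
    have "a * b = 0"
    proof (rule ccontr)
      assume "a * b \<noteq> 0"
      then obtain j l where "2 * int j = v" "2 * int l = w"
        using p q by (metis leads_def mult_zero_left mult_zero_right)
      then have "j \<le> i" using i by linarith
      then show False using False \<open>2 * int j = v\<close> by blast
    qed
    moreover have "Polynomial.coeff (p * q) i = 0"
      unfolding coeff_mult
      by (rule sum.neutral) (use i False in \<open>auto intro!: out\<close>)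
    ultimately show ?thesis by simp
  qed
  have 3: "a * b = 0" if none: "\<nexists>i. 2 * int i = v + w"
  proof (rule ccontr)
    assume "a * b \<noteq> 0"
    then obtain j l where "2 * int j = v" "2 * int l = w"
      using p q by (metis leads_def mult_zero_left mult_zero_right)
    then have "2 * int (j + l) = v + w" by simp
    then show False using none by blast
  qed
  show ?thesis unfolding leads_def using 1 2 3 by blast
qed

text \<open>The factor 2 keeps the leading coefficient equal to the weight times \<open>a\<close>.\<close>

lemma leads_pderiv:
  fixes p :: "'a::{comm_ring_1, semiring_no_zero_divisors} poly"
  assumes "leads p w a"
  shows "leads (Polynomial.smult 2 (pderiv p)) (w - 2) (of_int w * a)"
proof -
  have 1: "Polynomial.coeff (Polynomial.smult 2 (pderiv p)) i = 0" if "w - 2 < 2 * int i" for i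
  proof -
    have "w < 2 * int (Suc i)" using that by simp
    then show ?thesis using assms by (simp add: leads_def coeff_pderiv del: of_nat_Suc)
  qed
  have 2: "Polynomial.coeff (Polynomial.smult 2 (pderiv p)) i = of_int w * a"
    if "2 * int i = w - 2" for i
  proof -
    have w: "w = 2 * int (Suc i)" using that by simp
    then have "Polynomial.coeff p (Suc i) = a" using assms unfolding leads_def by blast
    moreover have "(of_int w :: 'a) = 2 * of_nat (Suc i)"
      unfolding w by (simp del: of_nat_Suc)
    ultimately show ?thesis by (simp add: coeff_pderiv del: of_nat_Suc)
  qed
  have 3: "of_int w * a = 0" if none: "\<nexists>i. 2 * int i = w - 2"
  proof (rule ccontr)
    assume nz: "of_int w * a \<noteq> 0"
    then obtain i where i: "2 * int i = w"
      using assms unfolding leads_def by fastforce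
    \<comment> \<open>The exponent \<open>i = 0\<close> would mean \<open>w = 0\<close>, and then
      the factor \<open>of_int w\<close> kills the product.\<close>
    moreover have "i \<noteq> 0" using nz i by (cases i) auto
    ultimately have "2 * int (i - 1) = w - 2" by (simp add: of_nat_diff)
    then show False using none by blast
  qed
  show ?thesis unfolding leads_def using 1 2 3 by blast
qed



section \<open>Coprime polynomials over a field\<close>

text \<open>The extended Euclidean algorithm. It serves to cancel h' in
  \<open>h dvd pderiv h * p\<close>.\<close>

lemma coprime_poly_bezout:
  fixes a b :: "'a::field poly"
  assumes "coprime a b"
  shows "\<exists>s t. s * a + t * b = 1"
  using assms
\<comment> \<open>The measure separates \<open>b = 0\<close> from the non-zero constants, which also
  have degree 0, so it still drops when division by a constant leaves no remainder.\<close>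
proof (induction "if b = 0 then 0 else Suc (Polynomial.degree b)" arbitrary: a b rule: less_induct)
  case less
  show ?case
  proof (cases "b = 0")
    case True
    then have "a dvd 1" using less.prems by simp
    then obtain s where "1 = a * s" by (rule dvdE)
    then have "s * a + 0 * b = 1" by (simp add: mult.commute)
    then show ?thesis by blast
  next
    case False
    have "coprime b (a mod b)"
      using less.prems False by (simp add: coprime_commute)
    moreover have "(if a mod b = 0 then 0 else Suc (Polynomial.degree (a mod b)))
        < (if b = 0 then 0 else Suc (Polynomial.degree b))"
      using degree_mod_less[OF False, of a] False by auto
    ultimately obtain s t where "s * b + t * (a mod b) = 1"
      using less.hyps by blast
    then have "s * b + t * (a - a div b * b) = 1" by (simp add: minus_div_mult_eq_mod)
    then have "t * a + (s - t * (a div b)) * b = 1" by (simp add: algebra_simps)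
    then show ?thesis by blast
  qed
qed

lemma coprime_poly_dvd_mult:
  fixes a b c :: "'a::field poly"
  assumes "coprime a b" "a dvd b * c"
  shows "a dvd c"
proof -
  obtain s t where "s * a + t * b = 1" using coprime_poly_bezout assms by blast
  then have "c = c * (s * a + t * b)" by simp
  then have "c = (s * c) * a + t * (b * c)" by (simp only: algebra_simps)
  moreover have "a dvd (s * c) * a + t * (b * c)" using assms by simp
  ultimately show ?thesis by simp
qed


section \<open>The lifted vector field on the plane\<close>

text \<open>The partial derivative in x, with y held constant; \<open>pderiv\<close> on the outer
  polynomials is the one in y.\<close>

definition dx :: "'a::field poly poly \<Rightarrow> 'a poly poly"
  where "dx = map_poly pderiv"

lemma dx_0 [simp]: "dx 0 = 0"
  by (simp add: dx_def)

lemma dx_pCons [simp]: "dx (pCons a u) = pCons (pderiv a) (dx u)"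
  by (simp add: dx_def map_poly_pCons)

lemma coeff_dx: "Polynomial.coeff (dx u) i = pderiv (Polynomial.coeff u i)"
  by (simp add: dx_def coeff_map_poly)

lemma dx_add: "dx (u + v) = dx u + dx v"
  by (rule poly_eqI) (simp add: coeff_dx pderiv_add)

lemma dx_smult: "dx (Polynomial.smult a u) = Polynomial.smult (pderiv a) u + Polynomial.smult a (dx u)"
  by (rule poly_eqI) (simp add: coeff_dx pderiv_mult algebra_simps)

lemma dx_mult: "dx (u * v) = dx u * v + u * dx v"
proof (induction u)
  case (pCons a u)
  have "dx (pCons a u * v) = dx (Polynomial.smult a v) + pCons 0 (dx (u * v))"
    by (simp add: dx_add)
  then show ?case using pCons by (simp add: dx_smult algebra_simps)
qed simp

locale hyperelliptic =
  fixes h :: "'k::field_char_0 poly" and m :: nat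
  assumes m_pos: "m \<ge> 1"
    and deg_h: "Polynomial.degree h = 2 * m + 1"
    and lc_h: "Polynomial.lead_coeff h = 1"
    and cop: "coprime h (pderiv h)"
begin

definition curve :: "'k poly poly"
  where "curve = [:0, 1:] ^ 2 - [:2 * h:]"

lemma curve_pCons: "curve = [:- 2 * h, 0, 1:]"
  by (simp add: curve_def power2_eq_square)

definition const :: "'k \<Rightarrow> 'k poly poly"
  where "const c = [:[:c:]:]"

lemma const_simps: "const 0 = 0" "const 1 = 1" "const (a + b) = const a + const b"
    "const (a * b) = const a * const b" "const (- a) = - const a" "dx (const a) = 0"
    "pderiv (const a) = 0"
  by (simp_all add: const_def one_pCons pderiv_pCons)

definition tau :: "'k poly poly \<Rightarrow> 'k poly poly"
  where "tau u = [:0, 1:] * dx u + [:pderiv h:] * pderiv u"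

text \<open>The coefficient of \<open>tau\<close> in the commutator of \<open>f tau\<close> and
  \<open>g tau\<close>.\<close>

definition bracket :: "'k poly poly \<Rightarrow> 'k poly poly \<Rightarrow> 'k poly poly"
  where "bracket f g = f * tau g - g * tau f"

lemma tau_add: "tau (u + v) = tau u + tau v"
  by (simp add: tau_def dx_add pderiv_add algebra_simps)

lemma tau_mult: "tau (u * v) = tau u * v + u * tau v"
  by (simp only: tau_def dx_mult pderiv_mult) (simp only: algebra_simps)

lemma tau_const: "tau (const c) = 0"
  by (simp add: tau_def const_simps)

lemma tau_diff: "tau (u - v) = tau u - tau v"
  using tau_add[of "u - v" v] by (simp add: algebra_simps)

text \<open>The term \<open>- 2 h' y\<close> from the x-part cancels \<open>2 y h'\<close> from the
  y-part. Hence \<open>tau\<close> preserves the ideal of the curve and descends to the coordinate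
  ring.\<close>

lemma tau_curve: "tau curve = 0"
  by (simp add: tau_def curve_pCons pderiv_pCons pderiv_mult numeral_poly pderiv_minus pderiv_smult)

lemma tau_cong: "curve dvd u - v \<Longrightarrow> curve dvd tau u - tau v"
  by (metis dvd_def tau_curve tau_diff tau_mult mult_zero_left add_0)

lemma bracket_cong:
  assumes "curve dvd f - f'" "curve dvd g - g'"
  shows "curve dvd bracket f g - bracket f' g'"
proof -
  have "bracket f g - bracket f' g' =
      (f - f') * tau g + f' * (tau g - tau g') - ((g - g') * tau f + g' * (tau f - tau f'))"
    unfolding bracket_def by (simp only: algebra_simps)
  then show ?thesis
    using assms tau_cong[OF assms(1)] tau_cong[OF assms(2)]
    by (metis dvd_add dvd_diff dvd_mult dvd_mult2)
qed

section \<open>Normal forms p + q y modulo the curve\<close>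

lemma normal_form: "\<exists>p q. curve dvd u - [:p, q:]"
proof (induction u)
  case 0
  then show ?case by (metis diff_self dvd_0_right pCons_0_0)
next
  case (pCons a u)
  then obtain p q where "curve dvd u - [:p, q:]" by blast
  \<comment> \<open>Horner step: y (p + q y) becomes 2 h q + p y once y^2 is replaced by 2
    h.\<close>
  moreover have "pCons a u - [:a + 2 * h * q, p:] = [:0, 1:] * (u - [:p, q:]) + [:q:] * curve"
    by (simp add: curve_pCons algebra_simps)
  ultimately have "curve dvd pCons a u - [:a + 2 * h * q, p:]"
    by (metis dvd_add dvd_mult dvd_refl)
  then show ?case by blast
qed

text \<open>The curve has degree 2 in y and k[x] has no zero divisors, so its non-zero multiples
  have degree at least 2 in y.\<close>

lemma normal_form_zero:
  assumes "curve dvd [:p, q:]"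
  shows "p = 0 \<and> q = 0"
proof -
  obtain g where g: "[:p, q:] = curve * g" using assms by (auto elim: dvdE)
  have deg: "Polynomial.degree curve = 2" "curve \<noteq> 0"
    by (simp_all add: curve_pCons)
  have "g = 0"
  proof (rule ccontr)
    assume "g \<noteq> 0"
    then have "Polynomial.degree [:p, q:] = 2 + Polynomial.degree g"
      using deg by (simp add: g degree_mult_eq)
    then show False by (auto split: if_splits)
  qed
  then show ?thesis using g by simp
qed


section \<open>Leading terms on the curve\<close>

text \<open>
  On the curve \<open>u = p + q y\<close>; the weights of \<open>p\<close> are even and those of \<open>q y\<close> are odd, so at most one
  of \<open>a\<close> and \<open>b\<close> is non-zero.
\<close>

definition has_lead :: "'k poly poly \<Rightarrow> int \<Rightarrow> 'k \<Rightarrow> 'k \<Rightarrow> bool"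
  where "has_lead u w a b \<longleftrightarrow>
    (\<exists>p q. curve dvd u - [:p, q:] \<and> leads p w a \<and> leads q (w - (2 * int m + 1)) b)"

lemma has_lead_even: "has_lead u w a b \<Longrightarrow> a \<noteq> 0 \<Longrightarrow> even w"
  unfolding has_lead_def using leads_even by blast

lemma has_lead_odd: "has_lead u w a b \<Longrightarrow> b \<noteq> 0 \<Longrightarrow> odd w"
  unfolding has_lead_def using leads_even[of _ "w - (2 * int m + 1)" b] by auto

lemma has_lead_unique:
  assumes "has_lead u w a b" "has_lead u w a' b'"
  shows "a = a' \<and> b = b'"
proof -
  obtain p q where pq: "curve dvd u - [:p, q:]" "leads p w a" "leads q (w - (2 * int m + 1)) b"
    using assms(1) unfolding has_lead_def by blast
  obtain r s where rs: "curve dvd u - [:r, s:]" "leads r w a'" "leads s (w - (2 * int m + 1)) b'"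
    using assms(2) unfolding has_lead_def by blast
  have "curve dvd (u - [:r, s:]) - (u - [:p, q:])"
    using pq(1) rs(1) by (rule dvd_diff[rotated])
  then have "curve dvd [:p - r, q - s:]" by simp
  then have "p = r \<and> q = s" using normal_form_zero[of "p - r" "q - s"] by simp
  then show ?thesis using pq rs leads_unique by blast
qed

lemma has_lead_above: "has_lead u w a b \<Longrightarrow> w < v \<Longrightarrow> has_lead u v 0 0"
  unfolding has_lead_def by (metis leads_above diff_strict_right_mono)

lemma has_lead_dvd: "curve dvd u \<Longrightarrow> has_lead u w 0 0"
  unfolding has_lead_def by (metis leads_zero pCons_0_0 diff_zero)

lemma has_lead_diff:
  assumes "has_lead u w a b" "has_lead v w a' b'"
  shows "has_lead (u - const c * v) w (a - c * a') (b - c * b')"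
proof -
  obtain p q where pq: "curve dvd u - [:p, q:]" "leads p w a" "leads q (w - (2 * int m + 1)) b"
    using assms(1) unfolding has_lead_def by blast
  obtain r s where rs: "curve dvd v - [:r, s:]" "leads r w a'" "leads s (w - (2 * int m + 1)) b'"
    using assms(2) unfolding has_lead_def by blast
  have "u - const c * v - [:p - Polynomial.smult c r, q - Polynomial.smult c s:]
      = (u - [:p, q:]) - const c * (v - [:r, s:])"
    by (simp add: const_def algebra_simps)
  then have "curve dvd u - const c * v - [:p - Polynomial.smult c r, q - Polynomial.smult c s:]"
    using pq(1) rs(1) by (metis dvd_diff dvd_mult)
  then show ?thesis
    unfolding has_lead_def using pq rs leads_diff leads_smult by blast
qed

text \<open>The weights of the two components have different parity, so they cannot tie, and the
  larger one is the weight of \<open>u\<close>.\<close>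

lemma has_lead_exists:
  assumes "\<not> curve dvd u"
  shows "\<exists>w a b. 0 \<le> w \<and> has_lead u w a b \<and> (a \<noteq> 0 \<or> b \<noteq> 0)"
proof -
  obtain p q where pq: "curve dvd u - [:p, q:]" using normal_form by blast
  have nz: "p \<noteq> 0 \<or> q \<noteq> 0" using assms pq by auto
  define d e where "d = 2 * int (Polynomial.degree p)"
    and "e = 2 * int (Polynomial.degree q) + (2 * int m + 1)"
  have p: "leads p d (Polynomial.lead_coeff p)"
    unfolding d_def by (rule leads_degree)
  have q: "leads q (e - (2 * int m + 1)) (Polynomial.lead_coeff q)"
    using leads_degree[of q] by (simp add: e_def)
  have pos: "0 \<le> d" "0 \<le> e" by (simp_all add: d_def e_def)
  have "d \<noteq> e" unfolding d_def e_def by presburger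
  \<comment> \<open>A zero component is set apart: since the degree of 0 is 0, its \<open>d\<close>
    or \<open>e\<close> would be a spurious weight.\<close>
  then consider "q = 0" | "p = 0" | "p \<noteq> 0" "e < d" | "q \<noteq> 0" "d < e" using nz by linarith
  then show ?thesis
  proof cases
    case 1
    then show ?thesis
      using nz pq p pos leads_zero unfolding has_lead_def by (metis leading_coeff_0_iff)
  next
    case 2
    then show ?thesis
      using nz pq q pos leads_zero unfolding has_lead_def by (metis leading_coeff_0_iff)
  next
    case 3
    then have "leads q (d - (2 * int m + 1)) 0" using q leads_above by fastforce
    then show ?thesis
      using 3 pq p pos unfolding has_lead_def by (metis leading_coeff_0_iff)
  next
    case 4
    then have "leads p e 0" using p leads_above by blast
    then show ?thesis
      using 4 pq q pos unfolding has_lead_def by (metis leading_coeff_0_iff)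
  qed
qed

lemma bracket_normal_form:
  "curve dvd bracket [:p, q:] [:r, s:] -
    [:pderiv h * (p * s - r * q) + 2 * h * (p * pderiv s - s * pderiv p + q * pderiv r - r * pderiv q),
      p * pderiv r - r * pderiv p + 2 * h * (q * pderiv s - s * pderiv q):]"
proof -
  \<comment> \<open>The cofactor of \<open>curve\<close> consists of the coefficients of y^2 and y^3
    in the bracket.\<close>
  have "bracket [:p, q:] [:r, s:] -
    [:pderiv h * (p * s - r * q) + 2 * h * (p * pderiv s - s * pderiv p + q * pderiv r - r * pderiv q),
      p * pderiv r - r * pderiv p + 2 * h * (q * pderiv s - s * pderiv q):]
    = [:p * pderiv s - s * pderiv p + q * pderiv r - r * pderiv q, q * pderiv s - s * pderiv q:] * curve"
    by (simp add: bracket_def tau_def curve_pCons pderiv_pCons algebra_simps)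
  then show ?thesis by (metis dvd_triv_right)
qed

text \<open>On leading forms the curve is y^2 = 2 x^(2m+1). In weight v, \<open>tau\<close> sends
  x^i to (v/2) x^(i-1) y and x^i y to v x^(i+2m): it raises the weight by 2m - 1 and brings out a
  factor v. So f tau(g) and g tau(f) have the same leading form up to the factors v and w, and their
  difference carries v - w.\<close>

lemma has_lead_bracket:
  assumes "has_lead f w a b" "has_lead g v c d"
  shows "has_lead (bracket f g) (w + v + (2 * int m - 1))
    (of_int (v - w) * (a * d + b * c)) (of_int (v - w) * (a * c + 2 * b * d) / 2)"
proof -
  let ?N = "2 * int m + 1"
  obtain p q where pq: "curve dvd f - [:p, q:]" "leads p w a" "leads q (w - ?N) b"
    using assms(1) unfolding has_lead_def by blast
  obtain r s where rs: "curve dvd g - [:r, s:]" "leads r v c" "leads s (v - ?N) d"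
    using assms(2) unfolding has_lead_def by blast
  let ?D = "\<lambda>p. Polynomial.smult 2 (pderiv p)"
  have h: "leads h (2 * ?N) 1" using leads_degree[of h] deg_h lc_h by (simp add: algebra_simps)
  note D = leads_pderiv[OF pq(2)] leads_pderiv[OF pq(3)] leads_pderiv[OF rs(2)] leads_pderiv[OF rs(3)]
    leads_pderiv[OF h]
  let ?W1 = "pderiv h * (p * s - r * q) + 2 * h * (p * pderiv s - s * pderiv p + q * pderiv r - r * pderiv q)"
  let ?W2 = "p * pderiv r - r * pderiv p + 2 * h * (q * pderiv s - s * pderiv q)"
  have two: "(2::'k poly) = [:2:]" by (simp add: numeral_poly)
  \<comment> \<open>The derivatives are doubled to match \<open>leads_pderiv\<close>; the factor 1/2
    compensates.\<close>
  have e1: "?W1 = Polynomial.smult (1/2) (?D h * (p * s - r * q) +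
      Polynomial.smult 2 (h * (p * ?D s - s * ?D p + q * ?D r - r * ?D q)))"
    by (simp add: two smult_add_right smult_diff_right algebra_simps)
  have e2: "?W2 = Polynomial.smult (1/2) (p * ?D r - r * ?D p +
      Polynomial.smult 2 (h * (q * ?D s - s * ?D q)))"
    by (simp add: two smult_add_right smult_diff_right algebra_simps)
  let ?u = "w + v + (2 * int m - 1)"
  have ps: "leads (p * s - r * q) (w + v - ?N) (a * d - c * b)"
    by (rule leads_diff) (use leads_mult[OF pq(2) rs(3)] leads_mult[OF rs(2) pq(3)] in
        \<open>simp_all add: algebra_simps\<close>)
  have t1: "leads (?D h * (p * s - r * q)) ?u (of_int (2 * ?N) * (a * d - c * b))"
    using leads_mult[OF D(5) ps] by (simp add: algebra_simps)
  have t2: "leads (p * ?D s - s * ?D p + q * ?D r - r * ?D q) (w + v - ?N - 2)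
     (a * (of_int (v - ?N) * d) - d * (of_int w * a) + b * (of_int v * c) - c * (of_int (w - ?N) * b))"
    by (intro leads_add leads_diff)
      (use leads_mult[OF pq(2) D(4)] leads_mult[OF rs(3) D(1)] leads_mult[OF pq(3) D(3)]
         leads_mult[OF rs(2) D(2)] in \<open>simp_all add: algebra_simps\<close>)
  have t3: "leads (h * (p * ?D s - s * ?D p + q * ?D r - r * ?D q)) ?u
     (a * (of_int (v - ?N) * d) - d * (of_int w * a) + b * (of_int v * c) - c * (of_int (w - ?N) * b))"
    using leads_mult[OF h t2] by (simp add: algebra_simps)
  have l1: "leads ?W1 ?u (of_int (v - w) * (a * d + b * c))"
    unfolding e1 using leads_smult[OF leads_add[OF t1 leads_smult[OF t3, of 2]], of "1/2"]
    by (simp add: algebra_simps)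
  have t4: "leads (p * ?D r - r * ?D p) (?u - ?N) (a * (of_int v * c) - c * (of_int w * a))"
    by (intro leads_diff)
      (use leads_mult[OF pq(2) D(3)] leads_mult[OF rs(2) D(1)] in \<open>simp_all add: algebra_simps\<close>)
  have t5: "leads (q * ?D s - s * ?D q) (w + v - 2 * ?N - 2)
      (b * (of_int (v - ?N) * d) - d * (of_int (w - ?N) * b))"
    by (intro leads_diff)
      (use leads_mult[OF pq(3) D(4)] leads_mult[OF rs(3) D(2)] in \<open>simp_all add: algebra_simps\<close>)
  have t6: "leads (h * (q * ?D s - s * ?D q)) (?u - ?N)
      (b * (of_int (v - ?N) * d) - d * (of_int (w - ?N) * b))"
    using leads_mult[OF h t5] by (simp add: algebra_simps)
  have l2: "leads ?W2 (?u - ?N) (of_int (v - w) * (a * c + 2 * b * d) / 2)"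
    unfolding e2 using leads_smult[OF leads_add[OF t4 leads_smult[OF t6, of 2]], of "1/2"]
    by (simp add: field_simps)
  have "curve dvd bracket f g - bracket [:p, q:] [:r, s:] + (bracket [:p, q:] [:r, s:] - [:?W1, ?W2:])"
    by (rule dvd_add[OF bracket_cong[OF pq(1) rs(1)] bracket_normal_form])
  then have "curve dvd bracket f g - [:?W1, ?W2:]"
    by (simp only: diff_add_cancel diff_add_eq_diff_diff_swap add_diff_eq)
  then show ?thesis unfolding has_lead_def using l1 l2 by blast
qed

text \<open>By parity one of \<open>a\<close>, \<open>b\<close> and one of \<open>c\<close>,
  \<open>d\<close> vanish, so the single non-zero product of the others is left in one of the two
  leading coefficients. The term \<open>k\<close> is kept apart from \<open>g\<close> because
  \<open>bracket_eigen\<close> later replaces \<open>g\<close> inside the bracket but not in the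
  eigenvalue term.\<close>

lemma bracket_not_cong:
  assumes f: "has_lead f w a b" "a \<noteq> 0 \<or> b \<noteq> 0"
    and g: "has_lead g v c d" "c \<noteq> 0 \<or> d \<noteq> 0"
    and "w \<noteq> v" and k: "has_lead k u a' b'" "u < w + v + (2 * int m - 1)"
  shows "\<not> curve dvd bracket f g - const e * k"
proof
  assume dvd: "curve dvd bracket f g - const e * k"
  let ?c = "of_int (v - w) :: 'k"
  have "has_lead (bracket f g - const e * k) (w + v + (2 * int m - 1))
      (?c * (a * d + b * c) - e * 0) (?c * (a * c + 2 * b * d) / 2 - e * 0)"
    by (intro has_lead_diff has_lead_bracket f g has_lead_above[OF k])
  from has_lead_unique[OF this has_lead_dvd[OF dvd]]
  \<comment> \<open>In characteristic zero the factor v - w can be cancelled; \<open>k\<close>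
    contributes nothing in this weight.\<close>
  have "a * d + b * c = 0" "a * c + 2 * b * d = 0" using \<open>w \<noteq> v\<close> by auto
  moreover have "a = 0 \<or> b = 0" "c = 0 \<or> d = 0"
    using f(1) g(1) has_lead_even has_lead_odd by blast+
  ultimately show False using f(2) g(2) by auto
qed

lemma const_inverse_mult: "c \<noteq> 0 \<Longrightarrow> const (1 / c) * (const c * u) = u"
  by (simp only: mult.assoc[symmetric] const_simps(4)[symmetric]) (simp add: const_simps)

lemma const_dvd_cancel: "curve dvd const c * g \<Longrightarrow> c \<noteq> 0 \<Longrightarrow> curve dvd g"
  by (metis const_inverse_mult dvd_mult)

lemma bracket_diff_const: "bracket f (g - const c * f) = bracket f g"
  by (simp add: bracket_def tau_diff tau_mult tau_const algebra_simps)

lemma bracket_eigen: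
  assumes f: "\<not> curve dvd f" and g: "\<not> curve dvd g"
    and eq: "curve dvd bracket f g - const c * g"
  shows "c = 0 \<and> (\<exists>d. curve dvd g - const d * f)"
proof -
  obtain w a b where w: "0 \<le> w" "has_lead f w a b" "a \<noteq> 0 \<or> b \<noteq> 0"
    using has_lead_exists[OF f] by blast
  obtain v a' b' where v: "0 \<le> v" "has_lead g v a' b'" "a' \<noteq> 0 \<or> b' \<noteq> 0"
    using has_lead_exists[OF g] by blast
  \<comment> \<open>As m is at least 1, the bracket would lie strictly above \<open>g\<close> in
    weight if the weights differed.\<close>
  have "v < w + v + (2 * int m - 1)" using w m_pos by linarith
  then have "w = v" using bracket_not_cong[OF w(2,3) v(2,3) _ v(2)] eq by blast
  \<comment> \<open>The ratio of the leading coefficients; equal weights have equal parity, so both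
    sit in the same component.\<close>
  define d where "d = (if a \<noteq> 0 then a' / a else b' / b)"
  have "a = 0 \<or> b = 0" "a \<noteq> 0 \<Longrightarrow> b' = 0" "b \<noteq> 0 \<Longrightarrow> a' = 0"
    using w v \<open>w = v\<close> has_lead_even has_lead_odd by blast+
  then have z: "a' - d * a = 0" "b' - d * b = 0" using w(3) by (auto simp: d_def)
  have red: "has_lead (g - const d * f) w 0 0"
    using has_lead_diff[of g w a' b' f a b d] w v \<open>w = v\<close> z by simp
  have "curve dvd g - const d * f"
  proof (rule ccontr)
    assume "\<not> curve dvd g - const d * f"
    then obtain u a1 b1 where u: "0 \<le> u" "has_lead (g - const d * f) u a1 b1" "a1 \<noteq> 0 \<or> b1 \<noteq> 0"
      using has_lead_exists by blast
    \<comment> \<open>The leading terms have cancelled in weight \<open>w\<close>, and nothing lies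
      above it.\<close>
    have "u < w"
      using u red has_lead_above has_lead_unique by (metis linorder_neqE)
    \<comment> \<open>Even a remainder of weight 0 would have a bracket with \<open>f\<close> above
      the weight of \<open>g\<close>. Subtracting a multiple of \<open>f\<close> leaves the bracket
      unchanged.\<close>
    moreover have "v < w + u + (2 * int m - 1)" using u m_pos \<open>w = v\<close> by linarith
    ultimately show False
      using bracket_not_cong[OF w(2,3) u(2,3) _ v(2)] eq bracket_diff_const by auto
  qed
  \<comment> \<open>With \<open>g\<close> a scalar multiple of \<open>f\<close> the bracket vanishes
    on the curve, which leaves \<open>c g = 0\<close>.\<close>
  moreover from this have "curve dvd bracket f (g - const d * f) - bracket f 0"
    by (intro bracket_cong) auto
  then have "curve dvd bracket f g"
    by (simp only: bracket_diff_const) (simp add: bracket_def tau_def)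
  then have "curve dvd bracket f g - (bracket f g - const c * g)"
    using eq by (rule dvd_diff)
  then have "curve dvd const c * g" by simp
  then have "c = 0" using const_dvd_cancel g by blast
  ultimately show ?thesis by blast
qed


section \<open>Derivations of the coordinate ring\<close>

abbreviation A where "A \<equiv> curve_algebra h"
abbreviation V where "V \<equiv> vector_fields h"

section \<open>Arithmetic of residue classes\<close>

definition cls :: "'k poly poly \<Rightarrow> 'k poly poly set"
  where "cls u = curve_ideal h +>\<^bsub>kxy\<^esub> u"

lemma kxy_simps: "carrier kxy = UNIV" "x \<otimes>\<^bsub>kxy\<^esub> y = x * y" "x \<oplus>\<^bsub>kxy\<^esub> y = x + y"
  by (simp_all add: ring_of_type_algebra_def)

lemma ideal_curve_ideal: "ideal (curve_ideal h) kxy"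
  unfolding curve_ideal_def
  by (rule ring.genideal_ideal) (auto simp: kxy_simps)

lemma curve_ideal_eq: "curve_ideal h = {u. curve dvd u}"
proof -
  interpret cring "kxy :: 'k poly poly ring" by rule
  have "curve_ideal h = PIdl\<^bsub>kxy\<^esub> curve"
    unfolding curve_ideal_def curve_def[symmetric]
    by (rule cgenideal_eq_genideal[symmetric]) (simp add: kxy_simps)
  then show ?thesis by (auto simp: cgenideal_def kxy_simps dvd_def mult.commute)
qed

lemma cls_eq: "cls u = {v. curve dvd v - u}"
  unfolding cls_def a_r_coset_def' curve_ideal_eq
  by (auto simp: kxy_simps)

lemma cls_eq_iff: "cls u = cls v \<longleftrightarrow> curve dvd u - v"
proof
  assume "cls u = cls v"
  moreover have "u \<in> cls u" by (simp add: cls_eq)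
  ultimately show "curve dvd u - v" by (simp add: cls_eq)
next
  assume uv: "curve dvd u - v"
  have "curve dvd w - u \<longleftrightarrow> curve dvd w - v" for w
    using dvd_add_left_iff[OF uv, of "w - u"] by simp
  then show "cls u = cls v" by (simp add: cls_eq)
qed

lemma carrier_A: "carrier A = range cls"
  by (auto simp: curve_algebra_def ring.defs FactRing_def A_RCOSETS_def' kxy_simps cls_def)

lemma zero_A: "\<zero>\<^bsub>A\<^esub> = cls 0"
  by (simp add: curve_algebra_def ring.defs FactRing_def cls_eq curve_ideal_eq)

lemma add_A: "cls u \<oplus>\<^bsub>A\<^esub> cls v = cls (u + v)"
proof -
  interpret ideal "curve_ideal h" "kxy :: 'k poly poly ring" by (rule ideal_curve_ideal)
  show ?thesis using a_rcos_sum[of u v]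
    by (simp add: curve_algebra_def ring.defs FactRing_def kxy_simps cls_def)
qed

lemma mult_Quot: "cls u \<otimes>\<^bsub>kxy Quot curve_ideal h\<^esub> cls v = cls (u * v)"
proof -
  interpret ideal "curve_ideal h" "kxy :: 'k poly poly ring" by (rule ideal_curve_ideal)
  show ?thesis using rcoset_mult_add[of u v]
    by (simp add: FactRing_def kxy_simps cls_def)
qed

lemma mult_A: "cls u \<otimes>\<^bsub>A\<^esub> cls v = cls (u * v)"
  using mult_Quot[of u v] by (simp add: curve_algebra_def ring.defs)

lemma smult_A: "c \<odot>\<^bsub>A\<^esub> cls u = cls (const c * u)"
  using mult_Quot[of "const c" u]
  by (simp add: curve_algebra_def ring.defs module.defs const_def cls_def)

lemma uminus_A: "\<ominus>\<^bsub>A\<^esub> cls u = cls (- u)"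
  unfolding a_inv_def m_inv_def
proof (rule the_equality)
  show "cls (- u) \<in> carrier (add_monoid A) \<and>
      cls u \<otimes>\<^bsub>add_monoid A\<^esub> cls (- u) = \<one>\<^bsub>add_monoid A\<^esub> \<and>
      cls (- u) \<otimes>\<^bsub>add_monoid A\<^esub> cls u = \<one>\<^bsub>add_monoid A\<^esub>"
    by (simp add: carrier_A add_A zero_A)
next
  fix y
  assume "y \<in> carrier (add_monoid A) \<and> cls u \<otimes>\<^bsub>add_monoid A\<^esub> y = \<one>\<^bsub>add_monoid A\<^esub> \<and>
      y \<otimes>\<^bsub>add_monoid A\<^esub> cls u = \<one>\<^bsub>add_monoid A\<^esub>"
  then obtain v where "y = cls v" "cls (u + v) = cls 0"
    by (auto simp: carrier_A add_A zero_A)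
  then show "y = cls (- u)" by (simp add: cls_eq_iff add.commute)
qed

lemma minus_A: "cls u \<ominus>\<^bsub>A\<^esub> cls v = cls (u - v)"
  by (simp add: a_minus_def uminus_A add_A)

section \<open>Derivations as multiples of \<open>tau\<close>\<close>

definition field_of :: "'k poly poly \<Rightarrow> 'k poly poly set \<Rightarrow> 'k poly poly set"
  where "field_of f = (\<lambda>a\<in>carrier A. cls (f * tau (SOME u. cls u = a)))"

text \<open>The representative picked by \<open>SOME\<close> differs from \<open>u\<close> by a
  multiple of the curve, which \<open>tau\<close> preserves.\<close>

lemma field_of_cls: "field_of f (cls u) = cls (f * tau u)"
proof -
  have "cls (SOME v. cls v = cls u) = cls u" by (rule someI) simp
  then have "curve dvd f * (tau (SOME v. cls v = cls u) - tau u)"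
    by (simp add: cls_eq_iff tau_cong)
  then have "cls (f * tau (SOME v. cls v = cls u)) = cls (f * tau u)"
    by (simp only: cls_eq_iff right_diff_distrib)
  moreover have "cls u \<in> carrier A" by (simp add: carrier_A)
  ultimately show ?thesis by (simp add: field_of_def)
qed

lemma field_of_derivation: "field_of f \<in> derivations base_field A"
  unfolding derivations_def
proof (intro CollectI conjI ballI PiE_I)
  fix a assume "a \<in> carrier A"
  then show "field_of f a \<in> carrier A" by (auto simp: carrier_A field_of_cls)
next
  fix a assume "a \<notin> carrier A"
  then show "field_of f a = undefined" by (simp add: field_of_def)
qed (auto simp: carrier_A field_of_cls add_A mult_A smult_A tau_add tau_mult tau_const cls_eq_iff
      algebra_simps)

text \<open>A derivation is determined by its values on x and y. It lifts to a derivation of the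
  plane that maps the curve equation into the ideal, and this constraint forces the pair of values
  to be a multiple of (y, h').\<close>

lemma derivation_eq_field_of:
  assumes D: "D \<in> derivations base_field A"
  shows "\<exists>f. D = field_of f"
proof -
  have D_add: "D (cls (u + v)) = D (cls u) \<oplus>\<^bsub>A\<^esub> D (cls v)"
    and D_mult: "D (cls (u * v)) = (D (cls u) \<otimes>\<^bsub>A\<^esub> cls v) \<oplus>\<^bsub>A\<^esub> (cls u \<otimes>\<^bsub>A\<^esub> D (cls v))"
    for u v
    using D unfolding derivations_def
    by (simp_all add: carrier_A add_A[symmetric] mult_A[symmetric])
  have D_smult: "D (cls (const c * u)) = c \<odot>\<^bsub>A\<^esub> D (cls u)" for c u
    using D unfolding derivations_def
    by (simp add: carrier_A smult_A[symmetric] ring_of_type_algebra_def)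
  have D_PiE: "D \<in> carrier A \<rightarrow>\<^sub>E carrier A"
    using D unfolding derivations_def by blast
  have D_cls: "D (cls u) \<in> range cls" for u
    using PiE_mem[OF D_PiE] by (simp add: carrier_A)
  have D_ext: "D a = undefined" if "a \<notin> carrier A" for a
    using D_PiE that by (rule PiE_arb)
  obtain u0 where u0: "D (cls [:[:0, 1:]:]) = cls u0" using D_cls by blast
  obtain v0 where v0: "D (cls [:0, 1:]) = cls v0" using D_cls by blast
  obtain p q where pq: "curve dvd u0 - [:p, q:]" using normal_form by blast
  obtain r s where rs: "curve dvd v0 - [:r, s:]" using normal_form by blast
  have Dx: "D (cls [:[:0, 1:]:]) = cls [:p, q:]" using u0 pq cls_eq_iff by auto
  have Dy: "D (cls [:0, 1:]) = cls [:r, s:]" using v0 rs cls_eq_iff by auto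
  \<comment> \<open>The lift to the plane: the derivation with value p + q y at x and r + s y at
    y.\<close>
  define E where "E u = [:p, q:] * dx u + [:r, s:] * pderiv u" for u
  have E_add: "E (u + v) = E u + E v" for u v
    by (simp only: E_def dx_add pderiv_add algebra_simps)
  have E_mult: "E (u * v) = E u * v + u * E v" for u v
    by (simp only: E_def dx_mult pderiv_mult) (simp only: algebra_simps)
  \<comment> \<open>The Leibniz rule for 1 * 1 gives D 1 = D 1 + D 1.\<close>
  have D_1: "D (cls 1) = cls 0"
  proof -
    obtain w where w: "D (cls 1) = cls w" using D_cls by blast
    then show ?thesis using D_mult[of 1 1] by (simp add: mult_A add_A cls_eq_iff)
  qed
  have D_const: "D (cls (const c)) = cls 0" for c
    using D_smult[of c 1] by (simp add: D_1 smult_A)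
  have D_poly: "D (cls [:a:]) = cls (E [:a:])" for a
  proof (induction a)
    case 0
    then show ?case using D_const[of 0] by (simp add: const_def E_def)
  next
    case (pCons c a)
    have eq: "[:pCons c a:] = const c + [:[:0, 1:]:] * [:a:]"
      by (simp add: const_def)
    have "D (cls [:pCons c a:]) = cls (0 + (E [:[:0, 1:]:] * [:a:] + [:[:0, 1:]:] * E [:a:]))"
      unfolding eq D_add D_mult D_const Dx pCons.IH mult_A add_A
      by (simp add: E_def pderiv_pCons)
    also have "\<dots> = cls (E [:pCons c a:])"
      unfolding eq E_add E_mult by (simp add: E_def const_simps)
    finally show ?case .
  qed
  have D_eq: "D (cls u) = cls (E u)" for u
  proof (induction u)
    case 0
    then show ?case using D_const[of 0] by (simp add: const_def E_def)
  next
    case (pCons a u)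
    have eq: "pCons a u = [:a:] + [:0, 1:] * u" by simp
    have "D (cls (pCons a u)) = cls (E [:a:] + (E [:0, 1:] * u + [:0, 1:] * E u))"
      unfolding eq D_add D_mult D_poly Dy pCons.IH mult_A add_A
      by (simp add: E_def pderiv_pCons)
    also have "\<dots> = cls (E (pCons a u))"
      unfolding eq E_add E_mult by simp
    finally show ?case .
  qed
  txt \<open>\<open>D\<close> kills \<open>y\<^sup>2 - 2 h\<close>, so \<open>y D y = h' D x\<close>; by coprimality \<open>D x\<close> is a multiple of \<open>y\<close>.\<close>
  have "cls (E curve) = cls 0"
    using D_eq[of curve] D_eq[of 0] cls_eq_iff[of curve 0] by (simp add: E_def)
  then have "curve dvd E curve" by (simp add: cls_eq_iff)
  \<comment> \<open>Directly, E(curve) is 2 y (r + s y) - 2 h' (p + q y); the multiple of the curve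
    trades 2 s y^2 for 4 h s.\<close>
  moreover have "E curve = [:4 * h * s - 2 * pderiv h * p, 2 * r - 2 * pderiv h * q:] + [:2 * s:] * curve"
    by (simp add: E_def curve_pCons pderiv_pCons pderiv_mult pderiv_minus pderiv_smult numeral_poly
        algebra_simps)
  ultimately have "curve dvd [:4 * h * s - 2 * pderiv h * p, 2 * r - 2 * pderiv h * q:]"
    by (metis dvd_add_left_iff dvd_triv_right)
  then have "4 * h * s - 2 * pderiv h * p = 0" "2 * r - 2 * pderiv h * q = 0"
    using normal_form_zero by blast+
  then have "2 * (pderiv h * p) = 2 * (2 * h * s)" "2 * r = 2 * (pderiv h * q)"
    by (simp_all add: algebra_simps)
  then have hp: "pderiv h * p = 2 * h * s" and r: "r = pderiv h * q"
    by (metis mult_cancel_left zero_neq_numeral)+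
  have "h dvd pderiv h * p" unfolding hp by simp
  then have "h dvd p" using coprime_poly_dvd_mult cop by blast
  then have "2 * h dvd 2 * p" by simp
  then obtain e0 where "2 * p = 2 * h * e0" by (elim dvdE)
  then have p0: "p = h * e0" by (metis mult.assoc mult_cancel_left zero_neq_numeral)
  \<comment> \<open>Halved so that p = 2 h e, which is e y^2 on the curve.\<close>
  define e where "e = Polynomial.smult (1/2) e0"
  have "e0 = 2 * e" by (simp add: e_def numeral_poly)
  then have p: "p = 2 * h * e" using p0 by simp
  have "h \<noteq> 0" using lc_h by auto
  moreover have "(2 * h) * s = (2 * h) * (pderiv h * e)"
    using hp unfolding p by (simp only: mult_ac)
  ultimately have s: "s = pderiv h * e" by simp
  \<comment> \<open>On the curve, (q + e y) y = p + q y is the value at x, and (q + e y) h' = r + s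
    y is the value at y.\<close>
  have "D = field_of [:q, e:]"
  proof
    fix a
    show "D a = field_of [:q, e:] a"
    proof (cases "a \<in> carrier A")
      case True
      then obtain u where a: "a = cls u" by (auto simp: carrier_A)
      have eqs: "[:p, q:] = [:q, e:] * [:0, 1:] - [:e:] * curve" "[:r, s:] = [:q, e:] * [:pderiv h:]"
        by (simp_all add: p s r curve_pCons mult_ac)
      have "[:q, e:] * tau u - E u = curve * ([:e:] * dx u)"
        unfolding E_def tau_def eqs by (simp only: algebra_simps)
      then have "cls ([:q, e:] * tau u) = cls (E u)"
        unfolding cls_eq_iff by (rule dvdI)
      then show ?thesis by (simp add: a D_eq field_of_cls)
    next
      case False
      then show ?thesis by (simp add: D_ext field_of_def)
    qed
  qed
  then show ?thesis by blast
qed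

lemma restrict_field_of: "(\<And>u. F (cls u) = cls (f * tau u)) \<Longrightarrow> restrict F (carrier A) = field_of f"
proof (rule ext)
  fix a
  assume F: "\<And>u. F (cls u) = cls (f * tau u)"
  show "restrict F (carrier A) a = field_of f a"
  proof (cases "a \<in> carrier A")
    case True
    then obtain u where "a = cls u" by (auto simp: carrier_A)
    then show ?thesis using True by (simp add: F field_of_cls)
  qed (simp add: field_of_def)
qed

text \<open>The value at x recovers f y, and y is not a zero divisor: (p + q y) y = 2 h q + p y
  vanishes only for p = q = 0.\<close>

lemma field_of_eq_iff: "field_of f = field_of g \<longleftrightarrow> curve dvd f - g"
proof
  assume "field_of f = field_of g"
  then have "field_of f (cls [:[:0, 1:]:]) = field_of g (cls [:[:0, 1:]:])" by simp
  moreover have "tau [:[:0, 1:]:] = [:0, 1:]" by (simp add: tau_def pderiv_pCons)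
  ultimately have y: "curve dvd (f - g) * [:0, 1:]"
    by (simp only: field_of_cls cls_eq_iff left_diff_distrib)
  obtain p q where pq: "curve dvd f - g - [:p, q:]" using normal_form by blast
  have "curve dvd (f - g) * [:0, 1:] - (f - g - [:p, q:]) * [:0, 1:] - [:q:] * curve"
    by (rule dvd_diff[OF dvd_diff[OF y dvd_mult2[OF pq]] dvd_triv_right])
  moreover have "(f - g) * [:0, 1:] - (f - g - [:p, q:]) * [:0, 1:] - [:q:] * curve = [:2 * h * q, p:]"
    unfolding left_diff_distrib by (simp add: curve_pCons algebra_simps)
  ultimately have "curve dvd [:2 * h * q, p:]" by simp
  then have "2 * h * q = 0 \<and> p = 0" by (rule normal_form_zero)
  moreover have "h \<noteq> 0" using lc_h by auto
  ultimately show "curve dvd f - g" using pq by simp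
next
  assume "curve dvd f - g"
  then have "cls (f * tau u) = cls (g * tau u)" for u
    by (simp add: cls_eq_iff left_diff_distrib[symmetric])
  then have "restrict (field_of f) (carrier A) = field_of g"
    by (intro restrict_field_of) (simp add: field_of_cls)
  then show "field_of f = field_of g" by (simp add: field_of_def)
qed

section \<open>The Lie algebra in terms of coefficients of \<open>tau\<close>\<close>

lemma carrier_V: "carrier V = range field_of"
  using derivation_eq_field_of field_of_derivation by (auto simp: vector_fields_def Der_def)

lemma zero_V: "\<zero>\<^bsub>V\<^esub> = field_of 0"
  by (simp add: vector_fields_def Der_def field_of_def zero_A)

lemma add_V: "field_of f \<oplus>\<^bsub>V\<^esub> field_of g = field_of (f + g)"
  unfolding vector_fields_def Der_def ring.simps
  by (rule restrict_field_of) (simp add: field_of_cls add_A distrib_right)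

lemma smult_V: "c \<odot>\<^bsub>V\<^esub> field_of f = field_of (const c * f)"
  unfolding vector_fields_def Der_def module.simps
  by (rule restrict_field_of) (simp add: field_of_cls smult_A mult.assoc)

lemma ad_V: "ad V (field_of f) (field_of g) = field_of (bracket f g)"
  unfolding ad_def vector_fields_def Der_def monoid.simps
proof (rule restrict_field_of)
  fix u
  have "f * tau (g * tau u) - g * tau (f * tau u) = bracket f g * tau u"
    by (simp add: bracket_def tau_mult algebra_simps)
  then show "field_of f (field_of g (cls u)) \<ominus>\<^bsub>A\<^esub> field_of g (field_of f (cls u))
      = cls (bracket f g * tau u)"
    by (simp add: field_of_cls minus_A)
qed

text \<open>Supplies the laws of \<open>finsum\<close>, in which diagonalizability is
  phrased.\<close>

lemma abelian_monoid_V: "abelian_monoid V"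
  by (rule abelian_monoidI) (auto simp: carrier_V zero_V add_V add_ac)

lemma ad_eq_smultD:
  assumes "field_of f \<noteq> \<zero>\<^bsub>V\<^esub>" "field_of g \<noteq> \<zero>\<^bsub>V\<^esub>"
    and "ad V (field_of f) (field_of g) = c \<odot>\<^bsub>V\<^esub> field_of g"
  shows "c = 0 \<and> (\<exists>d. field_of g = d \<odot>\<^bsub>V\<^esub> field_of f)"
  using bracket_eigen[of f g c] assms by (simp add: zero_V ad_V smult_V field_of_eq_iff)

lemma smult_zero_V: "v \<in> carrier V \<Longrightarrow> 0 \<odot>\<^bsub>V\<^esub> v = \<zero>\<^bsub>V\<^esub>"
  by (auto simp: carrier_V smult_V zero_V const_simps)

lemma ad_closed: "\<eta> \<in> carrier V \<Longrightarrow> \<nu> \<in> carrier V \<Longrightarrow> ad V \<eta> \<nu> \<in> carrier V"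
  by (auto simp: carrier_V ad_V)

lemma ad_smult:
  assumes "\<eta> \<in> carrier V" "\<nu> \<in> carrier V"
  shows "ad V \<eta> (c \<odot>\<^bsub>V\<^esub> \<nu>) = c \<odot>\<^bsub>V\<^esub> ad V \<eta> \<nu>"
  using assms
  by (auto simp: carrier_V ad_V smult_V bracket_def tau_mult tau_const algebra_simps)

lemma ad_add:
  assumes "\<eta> \<in> carrier V" "\<nu> \<in> carrier V" "\<mu> \<in> carrier V"
  shows "ad V \<eta> (\<nu> \<oplus>\<^bsub>V\<^esub> \<mu>) = ad V \<eta> \<nu> \<oplus>\<^bsub>V\<^esub> ad V \<eta> \<mu>"
  using assms
  by (auto simp: carrier_V ad_V add_V bracket_def tau_add algebra_simps)

lemma ad_zero: "\<eta> \<in> carrier V \<Longrightarrow> ad V \<eta> \<zero>\<^bsub>V\<^esub> = \<zero>\<^bsub>V\<^esub>"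
  by (auto simp: carrier_V ad_V zero_V bracket_def tau_def)

lemma ad_self: "\<eta> \<in> carrier V \<Longrightarrow> ad V \<eta> \<eta> = \<zero>\<^bsub>V\<^esub>"
  by (auto simp: carrier_V ad_V zero_V bracket_def)

section \<open>Kernel and image of ad, semisimple and nilpotent elements\<close>

lemma kernel_ad:
  assumes "\<eta> \<in> carrier V" "\<eta> \<noteq> \<zero>\<^bsub>V\<^esub>" "\<nu> \<in> carrier V" "ad V \<eta> \<nu> = \<zero>\<^bsub>V\<^esub>"
  shows "\<exists>d. \<nu> = d \<odot>\<^bsub>V\<^esub> \<eta>"
proof (cases "\<nu> = \<zero>\<^bsub>V\<^esub>")
  case True
  then show ?thesis using smult_zero_V assms by metis
next
  case False
  obtain f g where fg: "\<eta> = field_of f" "\<nu> = field_of g" using assms by (auto simp: carrier_V)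
  then show ?thesis
    using ad_eq_smultD[of f g 0] smult_zero_V[of \<nu>] False assms by simp
qed

lemma not_in_image_ad:
  assumes "\<eta> \<in> carrier V" "\<eta> \<noteq> \<zero>\<^bsub>V\<^esub>" "\<nu> \<in> carrier V"
  shows "ad V \<eta> \<nu> \<noteq> \<eta>"
proof
  assume eq: "ad V \<eta> \<nu> = \<eta>"
  obtain f g where fg: "\<eta> = field_of f" "\<nu> = field_of g" using assms by (auto simp: carrier_V)
  have "\<nu> \<noteq> \<zero>\<^bsub>V\<^esub>" using eq ad_zero assms by auto
  \<comment> \<open>By antisymmetry \<eta> becomes an eigenvector of \<open>ad V \<nu>\<close> with
    eigenvalue -1, whereas only 0 can occur.\<close>
  moreover have "ad V \<nu> \<eta> = (- 1) \<odot>\<^bsub>V\<^esub> \<eta>"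
  proof -
    have "curve dvd bracket f g - f" using eq by (simp add: fg ad_V field_of_eq_iff)
    moreover have "bracket g f - const (- 1) * f = - (bracket f g - f)"
      by (simp add: bracket_def const_simps)
    ultimately show ?thesis by (simp only: fg ad_V smult_V field_of_eq_iff dvd_minus_iff)
  qed
  ultimately show False using ad_eq_smultD[of g f "- 1"] assms fg by simp
qed

text \<open>Otherwise everything would lie on the line through \<eta>, but tau and x tau are
  linearly independent.\<close>

lemma ad_nonzero:
  assumes "\<eta> \<in> carrier V" "\<eta> \<noteq> \<zero>\<^bsub>V\<^esub>"
  shows "\<exists>\<nu>\<in>carrier V. ad V \<eta> \<nu> \<noteq> \<zero>\<^bsub>V\<^esub>"
proof (rule ccontr)
  assume "\<not> ?thesis"
  then have all: "\<exists>d. \<nu> = d \<odot>\<^bsub>V\<^esub> \<eta>" if "\<nu> \<in> carrier V" for \<nu>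
    using kernel_ad assms that by blast
  obtain f where f: "\<eta> = field_of f" using assms by (auto simp: carrier_V)
  obtain a where a: "field_of 1 = a \<odot>\<^bsub>V\<^esub> \<eta>" using all carrier_V by blast
  obtain b where b: "field_of [:[:0, 1:]:] = b \<odot>\<^bsub>V\<^esub> \<eta>" using all carrier_V by blast
  have 1: "curve dvd 1 - const a * f" "curve dvd [:[:0, 1:]:] - const b * f"
    using a b by (simp_all add: f smult_V field_of_eq_iff)
  \<comment> \<open>Eliminating \<open>f\<close> between the two relations leaves b - a x.\<close>
  have "curve dvd const b * (1 - const a * f) - const a * ([:[:0, 1:]:] - const b * f)"
    by (rule dvd_diff[OF dvd_mult[OF 1(1)] dvd_mult[OF 1(2)]])
  also have "const b * (1 - const a * f) - const a * ([:[:0, 1:]:] - const b * f) = [:[:b, - a:], 0:]"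
    unfolding right_diff_distrib by (simp add: const_def mult.commute)
  finally have "[:b, - a:] = 0" using normal_form_zero by blast
  then have "a = 0" by simp
  then have "curve dvd [:1, 0:]" using 1 by (simp add: const_simps one_pCons)
  then show False using normal_form_zero by fastforce
qed

lemma eigenvectors_ad:
  assumes "\<eta> \<in> carrier V" "\<eta> \<noteq> \<zero>\<^bsub>V\<^esub>" "w \<in> eigenvectors base_field V (ad V \<eta>)"
  shows "w \<in> carrier V \<and> ad V \<eta> w = \<zero>\<^bsub>V\<^esub>"
proof -
  obtain c where w: "w \<in> carrier V" "w \<noteq> \<zero>\<^bsub>V\<^esub>" "ad V \<eta> w = c \<odot>\<^bsub>V\<^esub> w"
    using assms(3) by (auto simp: eigenvectors_def)
  obtain f g where fg: "\<eta> = field_of f" "w = field_of g" using assms w by (auto simp: carrier_V)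
  have "c = 0" using ad_eq_smultD[of f g c] assms w fg by simp
  then show ?thesis using w smult_zero_V by simp
qed

lemma not_semisimple:
  assumes \<eta>: "\<eta> \<in> carrier V" "\<eta> \<noteq> \<zero>\<^bsub>V\<^esub>"
  shows "\<not> semisimple_element base_field V \<eta>"
proof
  assume ss: "semisimple_element base_field V \<eta>"
  interpret abelian_monoid V by (rule abelian_monoid_V)
  \<comment> \<open>The kernel is closed under linear combinations, so a span of eigenvectors stays
    inside it.\<close>
  have fin: "finsum V (\<lambda>w. c w \<odot>\<^bsub>V\<^esub> w) F \<in> carrier V \<and> ad V \<eta> (finsum V (\<lambda>w. c w \<odot>\<^bsub>V\<^esub> w) F) = \<zero>\<^bsub>V\<^esub>"
    if "finite F" "F \<subseteq> eigenvectors base_field V (ad V \<eta>)" for F and c :: "_ \<Rightarrow> 'k"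
    using that
  proof (induction F)
    case empty
    then show ?case using \<eta> by (simp add: ad_zero)
  next
    case (insert w F)
    have smult: "c v \<odot>\<^bsub>V\<^esub> v \<in> carrier V \<and> ad V \<eta> (c v \<odot>\<^bsub>V\<^esub> v) = \<zero>\<^bsub>V\<^esub>" if "v \<in> insert w F" for v
    proof -
      have v: "v \<in> carrier V" "ad V \<eta> v = \<zero>\<^bsub>V\<^esub>" using eigenvectors_ad \<eta> insert that by blast+
      then have "c v \<odot>\<^bsub>V\<^esub> v \<in> carrier V" "c v \<odot>\<^bsub>V\<^esub> \<zero>\<^bsub>V\<^esub> = \<zero>\<^bsub>V\<^esub>"
        by (auto simp: carrier_V smult_V zero_V)
      then show ?thesis using v \<eta> by (simp add: ad_smult)
    qed
    have "finsum V (\<lambda>w. c w \<odot>\<^bsub>V\<^esub> w) (insert w F) = c w \<odot>\<^bsub>V\<^esub> w \<oplus>\<^bsub>V\<^esub> finsum V (\<lambda>w. c w \<odot>\<^bsub>V\<^esub> w) F"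
      using insert smult by (intro finsum_insert) auto
    then show ?case using insert smult \<eta> by (simp add: ad_add)
  qed
  obtain \<nu> where \<nu>: "\<nu> \<in> carrier V" "ad V \<eta> \<nu> \<noteq> \<zero>\<^bsub>V\<^esub>" using ad_nonzero \<eta> by blast
  have "\<exists>F c. finite F \<and> F \<subseteq> eigenvectors base_field V (ad V \<eta>) \<and> c \<in> F \<rightarrow> carrier base_field \<and>
      \<nu> = finsum V (\<lambda>w. c w \<odot>\<^bsub>V\<^esub> w) F"
    using ss \<nu>(1) unfolding semisimple_element_def diagonalizable_def by (rule bspec)
  then obtain F c where F: "finite F" "F \<subseteq> eigenvectors base_field V (ad V \<eta>)"
      and sum: "\<nu> = finsum V (\<lambda>w. c w \<odot>\<^bsub>V\<^esub> w) F"
    by (elim exE conjE)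
  show False using fin[OF F, of c] \<nu>(2) sum by simp
qed

lemma ad_ad_eq_zero:
  assumes \<eta>: "\<eta> \<in> carrier V" "\<eta> \<noteq> \<zero>\<^bsub>V\<^esub>" and \<nu>: "\<nu> \<in> carrier V"
    and zero: "ad V \<eta> (ad V \<eta> \<nu>) = \<zero>\<^bsub>V\<^esub>"
  shows "ad V \<eta> \<nu> = \<zero>\<^bsub>V\<^esub>"
proof -
  obtain d where d: "ad V \<eta> \<nu> = d \<odot>\<^bsub>V\<^esub> \<eta>"
    using kernel_ad[OF \<eta> ad_closed[OF \<eta>(1) \<nu>] zero] by blast
  have "d = 0"
  proof (rule ccontr)
    assume "d \<noteq> 0"
    \<comment> \<open>Rescaling \<nu> by 1/d would put \<eta> itself into the image of its
      ad.\<close>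
    then have "(1 / d) \<odot>\<^bsub>V\<^esub> (d \<odot>\<^bsub>V\<^esub> \<eta>) = \<eta>"
      using \<eta> by (auto simp: carrier_V smult_V const_inverse_mult)
    then have "ad V \<eta> ((1 / d) \<odot>\<^bsub>V\<^esub> \<nu>) = \<eta>" using \<eta> \<nu> d by (simp add: ad_smult)
    moreover have "(1 / d) \<odot>\<^bsub>V\<^esub> \<nu> \<in> carrier V" using \<nu> by (auto simp: carrier_V smult_V)
    ultimately show False using not_in_image_ad \<eta> by blast
  qed
  then show ?thesis using d smult_zero_V \<eta> by simp
qed

lemma not_nilpotent:
  assumes \<eta>: "\<eta> \<in> carrier V" "\<eta> \<noteq> \<zero>\<^bsub>V\<^esub>"
  shows "\<not> nilpotent_element V \<eta>"
proof
  assume "nilpotent_element V \<eta>"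
  then obtain n where n: "\<And>v. v \<in> carrier V \<Longrightarrow> (ad V \<eta> ^^ n) v = \<zero>\<^bsub>V\<^esub>"
    by (auto simp: nilpotent_element_def nilpotent_operator_def)
  \<comment> \<open>Induction on the exponent: one ad is moved onto the argument, so the hypothesis
    gives ad^2 v = 0, and \<open>ad_ad_eq_zero\<close> lowers this to ad v = 0.\<close>
  have "ad V \<eta> v = \<zero>\<^bsub>V\<^esub>" if "v \<in> carrier V" "(ad V \<eta> ^^ k) v = \<zero>\<^bsub>V\<^esub>" for k v
    using that
  proof (induction k arbitrary: v)
    case 0
    then show ?case using \<eta> by (simp add: ad_zero)
  next
    case (Suc k)
    then have "(ad V \<eta> ^^ k) (ad V \<eta> v) = \<zero>\<^bsub>V\<^esub>" by (simp add: funpow_swap1)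
    then show ?case using Suc ad_closed ad_ad_eq_zero \<eta> by blast
  qed
  then show False using n ad_nonzero \<eta> by blast
qed

end

theorem theorem5p3:
  fixes h :: "'k::{alg_closed_field, field_char_0} poly" and m :: nat
    and \<eta> :: "'k poly poly set \<Rightarrow> 'k poly poly set"
  assumes "m \<ge> 1"
    and "Polynomial.degree h = 2 * m + 1" and "Polynomial.lead_coeff h = 1"
    and "coprime h (pderiv h)"
    and "\<eta> \<in> carrier (vector_fields h)" and "\<eta> \<noteq> \<zero>\<^bsub>vector_fields h\<^esub>"
  shows "a_kernel (vector_fields h) (vector_fields h) (ad (vector_fields h) \<eta>)
           = {c \<odot>\<^bsub>vector_fields h\<^esub> \<eta> | c. c \<in> carrier base_field}
       \<and> \<eta> \<notin> ad (vector_fields h) \<eta> ` carrier (vector_fields h)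
       \<and> \<not> (\<exists>\<nu>\<in>carrier (vector_fields h).
             \<nu> \<noteq> \<zero>\<^bsub>vector_fields h\<^esub> \<and> semisimple_element base_field (vector_fields h) \<nu>)
       \<and> \<not> (\<exists>\<nu>\<in>carrier (vector_fields h).
             \<nu> \<noteq> \<zero>\<^bsub>vector_fields h\<^esub> \<and> nilpotent_element (vector_fields h) \<nu>)"
proof -
  interpret hyperelliptic h m using assms(1-4) by unfold_locales
  have "a_kernel V V (ad V \<eta>) = {c \<odot>\<^bsub>V\<^esub> \<eta> | c. c \<in> carrier base_field}"
  proof -
    \<comment> \<open>The inclusion of the line in the kernel, from [\<eta>, \<eta>] = 0; the
      converse is \<open>kernel_ad\<close>.\<close>
    have "c \<odot>\<^bsub>V\<^esub> \<eta> \<in> carrier V \<and> ad V \<eta> (c \<odot>\<^bsub>V\<^esub> \<eta>) = \<zero>\<^bsub>V\<^esub>" for c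
    proof -
      have "c \<odot>\<^bsub>V\<^esub> \<eta> \<in> carrier V" "c \<odot>\<^bsub>V\<^esub> \<zero>\<^bsub>V\<^esub> = \<zero>\<^bsub>V\<^esub>"
        using assms(5) by (auto simp: carrier_V smult_V zero_V)
      then show ?thesis using assms(5) by (simp add: ad_smult ad_self)
    qed
    then show ?thesis
      using kernel_ad[OF assms(5,6)] by (auto simp: a_kernel_def' ring_of_type_algebra_def)
  qed
  moreover have "\<eta> \<notin> ad V \<eta> ` carrier V"
    using not_in_image_ad[OF assms(5,6)] by (simp add: image_iff eq_commute[of \<eta>])
  ultimately show ?thesis
    using not_semisimple not_nilpotent by blast
qed

end
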